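(* Let $\mathcal{H}$ be a Hilbert space. A sequence $(\theta_n)_{n=0}^\infty$ of normal states on $\mathcal{B}(\mathcal{H})$ is tight if and only if it is relatively compact in the norm topology (of the predual $\mathcal{B}(\mathcal{H})_*$).
   Context: Hilbert spaces are assumed separable; projections are orthogonal projections. A sequence $(\theta_n)_{n=0}^\infty$ of normal states on $\mathcal{B}(\mathcal{H})$ is called tight if for all $\epsilon>0$ there exists a finite dimensional projection $p\in\mathcal{B}(\mathcal{H})$ such that $\theta_n(p)>1-\epsilon$ for all $n$. *)

theory Defs
  imports "HOL-Analysis.Analysis"
begin

section \<open>Complex normed spaces and complex Hilbert spaces\<close>

text \<open>
  The distribution only provides real normed spaces and real inner product spaces. The complex
  structure is added on top of the real one, with compatible scalar multiplications.
\<close>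

class complex_vector = real_vector +
  fixes scaleC :: "complex \<Rightarrow> 'a \<Rightarrow> 'a"  (infixr \<open>*\<^sub>C\<close> 75)
  assumes scaleC_add_right: "a *\<^sub>C (x + y) = a *\<^sub>C x + a *\<^sub>C y"
    and scaleC_add_left: "(a + b) *\<^sub>C x = a *\<^sub>C x + b *\<^sub>C x"
    and scaleC_scaleC: "a *\<^sub>C b *\<^sub>C x = (a * b) *\<^sub>C x"
    and scaleR_scaleC: "r *\<^sub>R x = complex_of_real r *\<^sub>C x"

lemma vector_space_scaleC: "vector_space (scaleC :: complex \<Rightarrow> 'a::complex_vector \<Rightarrow> 'a)"
proof
  show "1 *\<^sub>C x = x" for x :: 'a
    using scaleR_scaleC[of 1 x] by simp
qed (simp_all add: scaleC_add_right scaleC_add_left scaleC_scaleC)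

global_interpretation complex_vector:
  vector_space "scaleC :: complex \<Rightarrow> 'a::complex_vector \<Rightarrow> 'a"
  by (rule vector_space_scaleC)

class complex_normed_vector = complex_vector + real_normed_vector +
  assumes norm_scaleC: "norm (a *\<^sub>C x) = cmod a * norm x"

text \<open>The inner product is linear in the second and conjugate linear in the first argument.\<close>

class complex_inner = complex_normed_vector +
  fixes cinner :: "'a \<Rightarrow> 'a \<Rightarrow> complex"
  assumes cinner_commute: "cinner x y = cnj (cinner y x)"
    and cinner_add_right: "cinner x (y + z) = cinner x y + cinner x z"
    and cinner_scaleC_right: "cinner x (a *\<^sub>C y) = a * cinner x y"
    and cinner_self_eq_norm: "cinner x x = complex_of_real ((norm x)\<^sup>2)"

class chilbert_space = complex_inner + complete_space

instantiation complex :: chilbert_space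
begin

definition scaleC_complex :: "complex \<Rightarrow> complex \<Rightarrow> complex"
  where "scaleC_complex a x = a * x"

definition cinner_complex :: "complex \<Rightarrow> complex \<Rightarrow> complex"
  where "cinner_complex x y = cnj x * y"

instance
  by standard
    (auto simp: scaleC_complex_def cinner_complex_def algebra_simps norm_mult scaleR_conv_of_real
      complex_norm_square simp flip: of_real_power)

end


section \<open>Bounded complex linear maps with the operator norm\<close>

typedef (overloaded) ('a, 'b) cblinfun =
  "{f :: 'a::complex_normed_vector \<Rightarrow> 'b::complex_normed_vector.
      bounded_linear f \<and> (\<forall>a x. f (a *\<^sub>C x) = a *\<^sub>C f x)}"
  morphisms cblinfun_apply CBlinfun
  by (rule exI[of _ "\<lambda>_. 0"]) simp

setup_lifting type_definition_cblinfun

declare [[coercion cblinfun_apply]]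

instantiation cblinfun :: (complex_normed_vector, complex_normed_vector) complex_normed_vector
begin

lift_definition norm_cblinfun :: "('a, 'b) cblinfun \<Rightarrow> real" is onorm .

lift_definition zero_cblinfun :: "('a, 'b) cblinfun" is "\<lambda>_. 0"
  by simp

lift_definition plus_cblinfun :: "('a, 'b) cblinfun \<Rightarrow> ('a, 'b) cblinfun \<Rightarrow> ('a, 'b) cblinfun"
  is "\<lambda>f g x. f x + g x"
  by (simp add: bounded_linear_add scaleC_add_right)

lift_definition minus_cblinfun :: "('a, 'b) cblinfun \<Rightarrow> ('a, 'b) cblinfun \<Rightarrow> ('a, 'b) cblinfun"
  is "\<lambda>f g x. f x - g x"
  by (simp add: bounded_linear_sub complex_vector.scale_right_diff_distrib)

lift_definition uminus_cblinfun :: "('a, 'b) cblinfun \<Rightarrow> ('a, 'b) cblinfun"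
  is "\<lambda>f x. - f x"
  by (simp add: bounded_linear_minus)

lift_definition scaleR_cblinfun :: "real \<Rightarrow> ('a, 'b) cblinfun \<Rightarrow> ('a, 'b) cblinfun"
  is "\<lambda>r f x. r *\<^sub>R f x"
  by (auto intro: bounded_linear_const_scaleR) (simp add: scaleR_scaleC scaleC_scaleC mult.commute)

lemma bounded_linear_scaleC:
  "bounded_linear ((*\<^sub>C) a :: 'c::complex_normed_vector \<Rightarrow> 'c)"
  by (rule bounded_linear_intro[where K = "cmod a"])
    (simp_all add: scaleC_add_right scaleR_scaleC scaleC_scaleC norm_scaleC mult.commute)

lift_definition scaleC_cblinfun :: "complex \<Rightarrow> ('a, 'b) cblinfun \<Rightarrow> ('a, 'b) cblinfun"
  is "\<lambda>a f x. a *\<^sub>C f x"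
  by (simp add: bounded_linear_compose[OF bounded_linear_scaleC] scaleC_scaleC mult.commute)

definition dist_cblinfun :: "('a, 'b) cblinfun \<Rightarrow> ('a, 'b) cblinfun \<Rightarrow> real"
  where "dist_cblinfun f g = norm (f - g)"

definition sgn_cblinfun :: "('a, 'b) cblinfun \<Rightarrow> ('a, 'b) cblinfun"
  where "sgn_cblinfun f = scaleR (inverse (norm f)) f"

definition [code del]:
  "(uniformity :: (('a, 'b) cblinfun \<times> ('a, 'b) cblinfun) filter) =
    (INF e\<in>{0 <..}. principal {(f, g). dist f g < e})"

definition open_cblinfun :: "('a, 'b) cblinfun set \<Rightarrow> bool"
  where [code del]:
    "open_cblinfun S = (\<forall>f\<in>S. \<forall>\<^sub>F (f', g) in uniformity. f' = f \<longrightarrow> g \<in> S)"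

lemma onorm_scaleC:
  assumes "bounded_linear (f :: 'c::complex_normed_vector \<Rightarrow> 'd::complex_normed_vector)"
  shows "onorm (\<lambda>x. a *\<^sub>C f x) = cmod a * onorm f"
proof -
  have "norm (a *\<^sub>C f x) = norm (cmod a *\<^sub>R f x)" for x
    by (simp add: norm_scaleC)
  then have "onorm (\<lambda>x. a *\<^sub>C f x) = onorm (\<lambda>x. cmod a *\<^sub>R f x)"
    by (simp only: onorm_def)
  with onorm_scaleR[OF assms, of "cmod a"] show ?thesis
    by simp
qed

instance
proof
  fix f g h :: "('a, 'b) cblinfun" and a b :: complex and r s :: real
  show "dist f g = norm (f - g)"
    by (rule dist_cblinfun_def)
  show "sgn f = scaleR (inverse (norm f)) f"
    by (rule sgn_cblinfun_def)
  show "uniformity = (INF e\<in>{0 <..}. principal {(f :: ('a, 'b) cblinfun, g). dist f g < e})"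
    by (rule uniformity_cblinfun_def)
  show "open S = (\<forall>f\<in>S. \<forall>\<^sub>F (f', g) in uniformity. f' = f \<longrightarrow> g \<in> S)"
    for S :: "('a, 'b) cblinfun set"
    by (rule open_cblinfun_def)
  show "f + g + h = f + (g + h)" "0 + f = f" "f + g = g + f" "- f + f = 0" "f - g = f + - g"
    by (transfer, simp add: algebra_simps)+
  show "r *\<^sub>R (f + g) = r *\<^sub>R f + r *\<^sub>R g" "(r + s) *\<^sub>R f = r *\<^sub>R f + s *\<^sub>R f"
    "r *\<^sub>R s *\<^sub>R f = (r * s) *\<^sub>R f" "1 *\<^sub>R f = f"
    by (transfer, simp add: algebra_simps)+
  show "a *\<^sub>C (f + g) = a *\<^sub>C f + a *\<^sub>C g" "(a + b) *\<^sub>C f = a *\<^sub>C f + b *\<^sub>C f"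
    "a *\<^sub>C b *\<^sub>C f = (a * b) *\<^sub>C f" "r *\<^sub>R f = complex_of_real r *\<^sub>C f"
    by (transfer, simp add: scaleC_add_right scaleC_add_left scaleC_scaleC scaleR_scaleC)+
  show "norm f = 0 \<longleftrightarrow> f = 0"
    by transfer (simp add: onorm_eq_0 fun_eq_iff)
  show "norm (f + g) \<le> norm f + norm g"
    by transfer (simp add: onorm_triangle)
  show "norm (r *\<^sub>R f) = \<bar>r\<bar> * norm f"
    by transfer (simp add: onorm_scaleR)
  show "norm (a *\<^sub>C f) = cmod a * norm f"
    by transfer (simp add: onorm_scaleC)
qed

end


section \<open>Operators and functionals\<close>

text \<open>The algebra \<open>B(H)\<close>, and its dual Banach space with the functional norm.\<close>

type_synonym 'a operator = "('a, 'a) cblinfun"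

type_synonym 'a functional = "('a operator, complex) cblinfun"

lift_definition id_operator :: "'a::complex_normed_vector operator" is "\<lambda>x. x"
  by (simp add: bounded_linear_ident)

definition selfadjoint :: "'a::complex_inner operator \<Rightarrow> bool"
  where "selfadjoint T \<longleftrightarrow> (\<forall>x y. cinner (T x) y = cinner x (T y))"

definition positive_operator :: "'a::complex_inner operator \<Rightarrow> bool"
  where "positive_operator T \<longleftrightarrow> (\<forall>x. cinner x (T x) \<in> \<real>\<^sub>\<ge>\<^sub>0)"

definition operator_le :: "'a::complex_inner operator \<Rightarrow> 'a operator \<Rightarrow> bool"
  where "operator_le S T \<longleftrightarrow> positive_operator (T - S)"

definition projection :: "'a::complex_inner operator \<Rightarrow> bool"
  where "projection p \<longleftrightarrow> selfadjoint p \<and> (\<forall>x. p (p x) = p x)"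

definition finite_dim_projection :: "'a::complex_inner operator \<Rightarrow> bool"
  where "finite_dim_projection p \<longleftrightarrow>
    projection p \<and> (\<exists>B. finite B \<and> range (cblinfun_apply p) = complex_vector.span B)"

definition state :: "'a::complex_inner functional \<Rightarrow> bool"
  where "state \<phi> \<longleftrightarrow>
    (\<forall>T. positive_operator T \<longrightarrow> \<phi> T \<in> \<real>\<^sub>\<ge>\<^sub>0) \<and> \<phi> id_operator = 1"


section \<open>Normality and the predual\<close>

definition operator_directed :: "'a::complex_inner operator set \<Rightarrow> bool"
  where "operator_directed D \<longleftrightarrow>
    D \<noteq> {} \<and> (\<forall>S\<in>D. \<forall>T\<in>D. \<exists>U\<in>D. operator_le S U \<and> operator_le T U)"

definition operator_lub :: "'a::complex_inner operator set \<Rightarrow> 'a operator \<Rightarrow> bool"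
  where "operator_lub D X \<longleftrightarrow>
    (\<forall>T\<in>D. operator_le T X) \<and> (\<forall>Y. (\<forall>T\<in>D. operator_le T Y) \<longrightarrow> operator_le X Y)"

text \<open>
  A bounded functional is normal if it converges to its value at the supremum along every
  increasing net of self-adjoint operators that has a supremum. Every increasing net can be
  replaced by its range, an upward directed set, regarded as a net indexed by itself. For positive
  functionals the condition says that suprema of such nets are preserved. Upper bounds of
  self-adjoint operators are self-adjoint, so \<open>operator_lub\<close> does not demand this.
\<close>

definition normal_functional :: "'a::complex_inner functional \<Rightarrow> bool"
  where "normal_functional \<phi> \<longleftrightarrow>
    (\<forall>D X. (\<forall>T\<in>D. selfadjoint T) \<and> operator_directed D \<and> operator_lub D X \<longrightarrow>
      (\<forall>\<epsilon>>0. \<exists>S\<in>D. \<forall>T\<in>D. operator_le S T \<longrightarrow> cmod (\<phi> T - \<phi> X) < \<epsilon>))"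

definition normal_state :: "'a::complex_inner functional \<Rightarrow> bool"
  where "normal_state \<phi> \<longleftrightarrow> state \<phi> \<and> normal_functional \<phi>"

text \<open>
  The predual of \<open>B(H)\<close> is the space of normal functionals, with the norm topology inherited
  from the dual of \<open>B(H)\<close>.
\<close>

definition predual_topology :: "'a::complex_inner functional topology"
  where "predual_topology = subtopology euclidean {\<phi>. normal_functional \<phi>}"

definition relatively_compactin :: "'a topology \<Rightarrow> 'a set \<Rightarrow> bool"
  where "relatively_compactin X S \<longleftrightarrow> S \<subseteq> topspace X \<and> compactin X (X closure_of S)"

text \<open>
  States take real values on projections, so taking the real part only changes the type.
\<close>

definition tight :: "(nat \<Rightarrow> 'a::complex_inner functional) \<Rightarrow> bool"
  where "tight \<theta> \<longleftrightarrow>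
    (\<forall>\<epsilon>>0. \<exists>p. finite_dim_projection p \<and> (\<forall>n. Re (\<theta> n p) > 1 - \<epsilon>))"

end

theory Submission
  imports Defs
begin

text \<open>
  A projection \<open>q\<close> nearly supporting a state \<open>\<phi>\<close> gives, by the Cauchy--Schwarz inequality for
  \<open>(S, T) \<mapsto> \<phi> (S\<^sup>* T)\<close>, that \<open>\<phi>\<close> is close in norm to its compression \<open>T \<mapsto> \<phi> (q T q)\<close>. If \<open>q\<close> is
  the sum of finitely many \<open>|e\<^sub>i\<rangle>\<langle>e\<^sub>i|\<close>, the compressions of all states lie in one compact set of
  combinations of the matrix coefficients \<open>T \<mapsto> \<langle>e\<^sub>i, T e\<^sub>j\<rangle>\<close>, so a tight sequence is totally bounded.
  The dual is complete and the predual is closed in it, whence relative compactness.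
  Conversely, the finite dimensional projections form a directed set with supremum \<open>1\<close>, so one of
  them nearly supports every member of a finite net of normal functionals.
\<close>


section \<open>Inner products and the Cauchy--Schwarz inequality\<close>

lemma cinner_add_left: "cinner (x + y) z = cinner x z + cinner y z"
  by (metis cinner_add_right cinner_commute complex_cnj_add)

lemma cinner_scaleC_left: "cinner (a *\<^sub>C x) y = cnj a * cinner x y"
  by (metis cinner_commute cinner_scaleC_right complex_cnj_mult)

lemma cinner_zero_right [simp]: "cinner x 0 = 0"
  using cinner_scaleC_right[of x 0 0] by simp

lemma cinner_zero_left [simp]: "cinner 0 x = 0"
  using cinner_scaleC_left[of 0 0 x] by simp

lemma cinner_minus_right: "cinner x (- y) = - cinner x y"
  using cinner_add_right[of x "- y" y] by (simp add: add_eq_0_iff2)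

lemma cinner_diff_right: "cinner x (y - z) = cinner x y - cinner x z"
  using cinner_add_right[of x y "- z"] by (simp add: cinner_minus_right)

lemma cinner_diff_left: "cinner (x - y) z = cinner x z - cinner y z"
  by (metis cinner_diff_right cinner_commute complex_cnj_diff)

lemma cinner_sum_right: "cinner x (\<Sum>i\<in>I. f i) = (\<Sum>i\<in>I. cinner x (f i))"
  by (induction I rule: infinite_finite_induct) (auto simp: cinner_add_right)

lemma cinner_left_eqI:
  assumes "\<And>z. cinner x z = cinner y z"
  shows "x = y"
proof -
  have "cinner (x - y) (x - y) = 0"
    by (simp add: cinner_diff_left assms)
  then show ?thesis
    by (simp add: cinner_self_eq_norm)
qed

text \<open>Hermitian symmetry of the form is not assumed; positivity on the diagonal implies it.\<close>

lemma sesquilinear_Cauchy_Schwarz: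
  fixes B :: "'a::complex_vector \<Rightarrow> 'a \<Rightarrow> complex"
  assumes add_left: "\<And>x y z. B (x + y) z = B x z + B y z"
    and add_right: "\<And>x y z. B x (y + z) = B x y + B x z"
    and scale_left: "\<And>a x y. B (a *\<^sub>C x) y = cnj a * B x y"
    and scale_right: "\<And>a x y. B x (a *\<^sub>C y) = a * B x y"
    and nonneg: "\<And>x. B x x \<in> \<real>\<^sub>\<ge>\<^sub>0"
  shows "(cmod (B x y))\<^sup>2 \<le> Re (B x x) * Re (B y y)"
proof -
  have ex: "B (x + c *\<^sub>C y) (x + c *\<^sub>C y) = B x x + c * B x y + cnj c * B y x + cnj c * c * B y y" for c
    by (simp add: add_left add_right scale_left scale_right algebra_simps)
  have pos: "Re (B z z) \<ge> 0" "Im (B z z) = 0" for z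
    using nonneg[of z] by (auto simp: complex_nonneg_Reals_iff)
  \<comment> \<open>The diagonal value at \<open>x + c *\<^sub>C y\<close> is real. Taking
    \<open>c = 1\<close> compares the imaginary parts of the two mixed terms,
    \<open>c = \<i>\<close> their real parts.\<close>
  have "Im (B x y) + Im (B y x) = 0"
    using pos(2)[of "x + 1 *\<^sub>C y"] unfolding ex by (simp add: pos)
  moreover have "Re (B x y) - Re (B y x) = 0"
    using pos(2)[of "x + \<i> *\<^sub>C y"] unfolding ex by (simp add: pos)
  ultimately have herm: "B y x = cnj (B x y)"
    by (simp add: complex_eq_iff)
  define m where "m = (cmod (B x y))\<^sup>2"
  have m: "m = (Re (B x y))\<^sup>2 + (Im (B x y))\<^sup>2"
    by (simp add: m_def cmod_power2)
  \<comment> \<open>The factor \<open>cnj (B x y)\<close> aligns phases: both mixed terms become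
    \<open>t * m\<close>, which leaves a real quadratic in \<open>t\<close>.\<close>
  have quad: "Re (B x x) + 2 * t * m + t\<^sup>2 * m * Re (B y y) \<ge> 0" for t :: real
    using pos(1)[of "x + (t * cnj (B x y)) *\<^sub>C y"] unfolding ex herm
    by (simp add: pos m power2_eq_square algebra_simps)
  have "m \<le> Re (B x x) * Re (B y y)"
  proof (cases "Re (B y y) = 0")
    case True
    \<comment> \<open>Without a quadratic term the bound is affine in \<open>t\<close>; the chosen
      \<open>t\<close> would make it equal to -1.\<close>
    have "m = 0"
    proof (rule ccontr)
      assume "m \<noteq> 0"
      then show False
        using quad[of "- (Re (B x x) + 1) / (2 * m)"] True by (simp add: field_simps)
    qed
    with True show ?thesis
      by simp
  next
    case False
    then have "Re (B y y) > 0"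
      using pos(1)[of y] by simp
    \<comment> \<open>The value -1 / \<open>Re (B y y)\<close> minimises the quadratic.\<close>
    then show ?thesis
      using quad[of "- 1 / Re (B y y)"] by (simp add: field_simps power2_eq_square)
  qed
  then show ?thesis
    by (simp add: m_def)
qed

lemma Cauchy_Schwarz_cinner: "cmod (cinner x y) \<le> norm x * norm y"
proof -
  have "(cmod (cinner x y))\<^sup>2 \<le> Re (cinner x x) * Re (cinner y y)"
    by (rule sesquilinear_Cauchy_Schwarz)
      (simp_all add: cinner_add_left cinner_add_right cinner_scaleC_left cinner_scaleC_right
        cinner_self_eq_norm)
  then have "(cmod (cinner x y))\<^sup>2 \<le> (norm x * norm y)\<^sup>2"
    by (simp add: cinner_self_eq_norm power_mult_distrib flip: of_real_power)
  then show ?thesis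
    by (rule power2_le_imp_le) simp
qed


section \<open>Algebra of bounded operators\<close>

lemma cblinfun_bounded_linear: "bounded_linear (cblinfun_apply T)"
  using cblinfun_apply[of T] by simp

lemma cblinfun_add_right: "cblinfun_apply T (x + y) = T x + T y"
  by (rule linear_simps[OF cblinfun_bounded_linear])

lemma cblinfun_diff_right: "cblinfun_apply T (x - y) = T x - T y"
  by (rule linear_simps[OF cblinfun_bounded_linear])

lemma cblinfun_zero_right [simp]: "cblinfun_apply T 0 = 0"
  by (rule linear_simps[OF cblinfun_bounded_linear])

lemma cblinfun_scaleC_right: "cblinfun_apply T (a *\<^sub>C x) = a *\<^sub>C T x"
  using cblinfun_apply[of T] by simp

lemma cblinfun_sum_right: "cblinfun_apply T (\<Sum>i\<in>I. f i) = (\<Sum>i\<in>I. T (f i))"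
  by (induction I rule: infinite_finite_induct) (auto simp: cblinfun_add_right)

lemmas cblinfun_apply_simps [simp] =
  zero_cblinfun.rep_eq plus_cblinfun.rep_eq minus_cblinfun.rep_eq uminus_cblinfun.rep_eq
  scaleC_cblinfun.rep_eq scaleR_cblinfun.rep_eq id_operator.rep_eq

lemma cblinfun_apply_sum [simp]:
  "cblinfun_apply (\<Sum>i\<in>I. f i) x = (\<Sum>i\<in>I. cblinfun_apply (f i) x)"
  by (induction I rule: infinite_finite_induct) auto

lemma cblinfun_eqI: "(\<And>x. cblinfun_apply S x = cblinfun_apply T x) \<Longrightarrow> S = T"
  by (metis cblinfun_apply_inject ext)

lemma norm_cblinfun_apply: "norm (cblinfun_apply T x) \<le> norm T * norm x"
  unfolding norm_cblinfun.rep_eq by (rule onorm[OF cblinfun_bounded_linear])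

lemma norm_cblinfun_bound:
  "0 \<le> b \<Longrightarrow> (\<And>x. norm (cblinfun_apply T x) \<le> b * norm x) \<Longrightarrow> norm T \<le> b"
  unfolding norm_cblinfun.rep_eq by (rule onorm_bound)

lift_definition cblinfun_comp ::
  "('b::complex_normed_vector, 'c::complex_normed_vector) cblinfun \<Rightarrow>
   ('a::complex_normed_vector, 'b) cblinfun \<Rightarrow> ('a, 'c) cblinfun"  (infixl \<open>\<circ>\<^sub>C\<close> 67)
  is "\<lambda>f g x. f (g x)"
  by (simp add: bounded_linear_compose)

declare cblinfun_comp.rep_eq [simp]

lemma norm_cblinfun_comp: "norm (S \<circ>\<^sub>C T) \<le> norm S * norm T"
proof (rule norm_cblinfun_bound)
  show "norm (cblinfun_apply (S \<circ>\<^sub>C T) x) \<le> norm S * norm T * norm x" for x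
    using norm_cblinfun_apply[of S "T x"] norm_cblinfun_apply[of T x]
    by (simp add: mult.assoc) (meson mult_left_mono norm_ge_zero order_trans)
qed simp

section \<open>Functionals and rank-one operators given by vectors\<close>

lift_definition bra :: "'a::complex_inner \<Rightarrow> ('a, complex) cblinfun" is cinner
proof (intro conjI allI)
  fix x :: 'a
  show "bounded_linear (cinner x)"
    by (rule bounded_linear_intro[where K = "norm x"])
      (simp_all add: cinner_add_right scaleR_scaleC cinner_scaleC_right scaleC_complex_def
        Cauchy_Schwarz_cinner mult.commute[of _ "norm x"])
  show "cinner x (a *\<^sub>C y) = a *\<^sub>C cinner x y" for a y
    by (simp add: cinner_scaleC_right scaleC_complex_def)
qed

text \<open>The operator \<open>|x\<rangle>\<langle>y|\<close> in bra-ket notation.\<close>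

lift_definition ketbra :: "'a::complex_inner \<Rightarrow> 'a \<Rightarrow> 'a operator"
  is "\<lambda>x y z. cinner y z *\<^sub>C x"
proof (intro conjI allI)
  fix x y :: 'a
  show "bounded_linear (\<lambda>z. cinner y z *\<^sub>C x)"
  proof (rule bounded_linear_intro[where K = "norm x * norm y"])
    show "norm (cinner y z *\<^sub>C x) \<le> norm z * (norm x * norm y)" for z
      using mult_right_mono[OF Cauchy_Schwarz_cinner[of y z], of "norm x"]
      by (simp add: norm_scaleC mult.commute mult.left_commute)
  qed (simp_all add: cinner_add_right scaleR_scaleC cinner_scaleC_right scaleC_add_left
      scaleC_scaleC)
  show "cinner y (a *\<^sub>C z) *\<^sub>C x = a *\<^sub>C cinner y z *\<^sub>C x" for a z
    by (simp add: cinner_scaleC_right scaleC_scaleC)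
qed

declare ketbra.rep_eq [simp] bra.rep_eq [simp]

lemma cblinfun_comp_add_left: "(R + S) \<circ>\<^sub>C T = R \<circ>\<^sub>C T + S \<circ>\<^sub>C T"
  by (rule cblinfun_eqI) simp

lemma cblinfun_comp_add_right: "R \<circ>\<^sub>C (S + T) = R \<circ>\<^sub>C S + R \<circ>\<^sub>C T"
  by (rule cblinfun_eqI) (simp add: cblinfun_add_right)

lemma cblinfun_comp_scaleC_left: "(a *\<^sub>C S) \<circ>\<^sub>C T = a *\<^sub>C (S \<circ>\<^sub>C T)"
  by (rule cblinfun_eqI) simp

lemma cblinfun_comp_scaleC_right: "S \<circ>\<^sub>C (a *\<^sub>C T) = a *\<^sub>C (S \<circ>\<^sub>C T)"
  by (rule cblinfun_eqI) (simp add: cblinfun_scaleC_right)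

text \<open>Here the scalar varies and the vector is fixed. The resulting continuity makes the
  multiples of a vector by scalars from a closed disc a compact set.\<close>

lemma bounded_linear_scaleC_left:
  "bounded_linear (\<lambda>c. c *\<^sub>C (v :: 'a::complex_normed_vector))"
  by (rule bounded_linear_intro[where K = "norm v"])
    (simp_all add: scaleC_add_left scaleR_conv_of_real scaleR_scaleC scaleC_scaleC norm_scaleC)

text \<open>The pointwise limit of a Cauchy sequence of maps is its limit in norm. For functionals
  this is the completeness that turns total boundedness into compactness.\<close>

instance cblinfun :: (complex_normed_vector, "{complex_normed_vector, complete_space}") complete_space
proof
  fix X :: "nat \<Rightarrow> ('a, 'b) cblinfun"
  assume X: "Cauchy X"
  have diff: "norm (X m x - X n x) \<le> norm (X m - X n) * norm x" for m n x
    using norm_cblinfun_apply[of "X m - X n" x] by simp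
  have "Cauchy (\<lambda>n. X n x)" for x
  proof (rule metric_CauchyI)
    fix e :: real
    assume "e > 0"
    \<comment> \<open>Adding 1 keeps the denominator positive at \<open>x = 0\<close>.\<close>
    then have "e / (norm x + 1) > 0"
      by (simp add: add_nonneg_pos)
    then obtain N where N: "\<And>m n. m \<ge> N \<Longrightarrow> n \<ge> N \<Longrightarrow> dist (X m) (X n) < e / (norm x + 1)"
      using metric_CauchyD[OF X] by blast
    have "dist (X m x) (X n x) < e" if "m \<ge> N" "n \<ge> N" for m n
    proof -
      have "dist (X m x) (X n x) \<le> norm (X m - X n) * (norm x + 1)"
        using diff[of m x n] norm_ge_zero[of "X m - X n"]
        by (simp only: dist_norm distrib_left)
      also have "\<dots> < e"
        using N[OF that] by (simp add: dist_norm pos_less_divide_eq add_nonneg_pos)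
      finally show ?thesis .
    qed
    then show "\<exists>M. \<forall>m\<ge>M. \<forall>n\<ge>M. dist (X m x) (X n x) < e"
      by blast
  qed
  then have "\<forall>x. \<exists>l. (\<lambda>n. X n x) \<longlonglongrightarrow> l"
    using Cauchy_convergent convergent_def by blast
  then obtain l where l: "\<And>x. (\<lambda>n. X n x) \<longlonglongrightarrow> l x"
    by metis
  have l_add: "l (x + y) = l x + l y" for x y
    using LIMSEQ_unique[OF l[of "x + y"]] tendsto_add[OF l[of x] l[of y]]
    by (simp add: cblinfun_add_right)
  have l_scale: "l (a *\<^sub>C x) = a *\<^sub>C l x" for a x
    using LIMSEQ_unique[OF l[of "a *\<^sub>C x"]]
      bounded_linear.tendsto[OF bounded_linear_scaleC l[of x], of a]
    by (simp add: cblinfun_scaleC_right)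
  from Cauchy_Bseq[OF X] obtain K where K: "\<And>n. norm (X n) \<le> K"
    by (auto simp: Bseq_def)
  have "bounded_linear l"
  proof (rule bounded_linear_intro[where K = K])
    show "norm (l x) \<le> norm x * K" for x
    proof (rule LIMSEQ_le_const2[OF tendsto_norm[OF l]], intro exI allI impI)
      show "norm (X n x) \<le> norm x * K" for n
        using norm_cblinfun_apply[of "X n" x] mult_right_mono[OF K[of n], of "norm x"]
        by (simp add: mult.commute)
    qed
  qed (simp_all add: l_add l_scale scaleR_scaleC)
  then have Y: "cblinfun_apply (CBlinfun l) = l"
    by (simp add: CBlinfun_inverse l_scale)
  have "X \<longlonglongrightarrow> CBlinfun l"
  proof (rule metric_LIMSEQ_I)
    fix e :: real
    assume "e > 0"
    \<comment> \<open>Letting \<open>m\<close> tend to infinity preserves only a weak inequality, so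
      half of \<open>e\<close> is kept in reserve.\<close>
    then have "e / 2 > 0"
      by simp
    then obtain N where N: "\<And>m n. m \<ge> N \<Longrightarrow> n \<ge> N \<Longrightarrow> dist (X m) (X n) < e / 2"
      using metric_CauchyD[OF X] by blast
    have "dist (X n) (CBlinfun l) < e" if "n \<ge> N" for n
    proof -
      have "norm (X n - CBlinfun l) \<le> e / 2"
      proof (rule norm_cblinfun_bound)
        fix x
        have "norm (X n x - l x) \<le> e / 2 * norm x"
        proof (rule LIMSEQ_le_const2[OF tendsto_norm[OF tendsto_diff[OF tendsto_const l]]],
            intro exI allI impI)
          fix m
          assume "N \<le> m"
          then have "norm (X n - X m) * norm x \<le> e / 2 * norm x"
            using N[OF that, of m] by (intro mult_right_mono) (simp_all add: dist_norm)
          then show "norm (X n x - X m x) \<le> e / 2 * norm x"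
            using diff[of n x m] by linarith
        qed
        then show "norm (cblinfun_apply (X n - CBlinfun l) x) \<le> e / 2 * norm x"
          by (simp add: Y)
      qed (use \<open>e > 0\<close> in simp)
      then show ?thesis
        using \<open>e > 0\<close> by (simp add: dist_norm)
    qed
    then show "\<exists>N. \<forall>n\<ge>N. dist (X n) (CBlinfun l) < e"
      by blast
  qed
  then show "convergent X"
    by (rule convergentI)
qed


section \<open>Riesz representation and adjoints\<close>

lemma norm_add_square:
  fixes x y :: "'a::complex_inner"
  shows "(norm (x + y))\<^sup>2 = (norm x)\<^sup>2 + 2 * Re (cinner x y) + (norm y)\<^sup>2"
proof -
  have "complex_of_real ((norm (x + y))\<^sup>2) = cinner (x + y) (x + y)"
    by (simp only: cinner_self_eq_norm)
  also have "\<dots> = cinner x x + cinner x y + cnj (cinner x y) + cinner y y"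
    by (simp add: cinner_add_left cinner_add_right flip: cinner_commute)
  also have "\<dots> = complex_of_real ((norm x)\<^sup>2 + 2 * Re (cinner x y) + (norm y)\<^sup>2)"
    by (simp add: cinner_self_eq_norm complex_eq_iff)
  finally show ?thesis
    by (simp only: of_real_eq_iff)
qed

text \<open>
  The representing vector minimises \<open>\<parallel>x\<parallel>\<^sup>2 - 2 Re (f x)\<close>; by the parallelogram law every
  minimising sequence is Cauchy.
\<close>

lemma Riesz_representation:
  fixes f :: "('a::chilbert_space, complex) cblinfun"
  shows "\<exists>y. \<forall>x. f x = cinner y x"
proof -
  define J where "J x = (norm x)\<^sup>2 - 2 * Re (f x)" for x
  \<comment> \<open>Completing the square in \<open>norm x\<close> after bounding
    \<open>Re (f x)\<close> by \<open>norm f * norm x\<close>.\<close>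
  have J_lower: "J x \<ge> - (norm f)\<^sup>2" for x
  proof -
    have "Re (f x) \<le> norm f * norm x"
      using norm_cblinfun_apply[of f x] complex_Re_le_cmod[of "f x"] by linarith
    moreover have "(norm x - norm f)\<^sup>2 \<ge> 0"
      by simp
    ultimately show ?thesis
      by (simp add: J_def power2_eq_square algebra_simps)
  qed
  have bdd: "bdd_below (range J)"
    using J_lower by (auto intro!: bdd_belowI)
  define m where "m = Inf (range J)"
  have m_le: "m \<le> J x" for x
    unfolding m_def using bdd by (auto intro: cInf_lower)
  have "\<exists>x. J x < m + 1 / real (Suc n)" for n
    using cInf_lessD[of "range J" "m + 1 / real (Suc n)"] by (auto simp: m_def)
  then obtain X where X: "\<And>n. J (X n) < m + 1 / real (Suc n)"
    by metis
  \<comment> \<open>At the midpoint of \<open>x\<close> and \<open>y\<close>, \<open>J\<close> is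
    still at least \<open>m\<close>; this bounds \<open>norm (x + y)\<close> from below.\<close>
  have par: "(norm (x - y))\<^sup>2 \<le> 2 * J x + 2 * J y - 4 * m" for x y
  proof -
    have "J ((1/2) *\<^sub>R (x + y)) = (norm (x + y))\<^sup>2 / 4 - Re (f x) - Re (f y)"
      by (simp add: J_def linear_simps(5)[OF cblinfun_bounded_linear] cblinfun_add_right
          power_divide add_divide_distrib)
    moreover have "(norm (x - y))\<^sup>2 + (norm (x + y))\<^sup>2 = 2 * (norm x)\<^sup>2 + 2 * (norm y)\<^sup>2"
      using norm_add_square[of x y] norm_add_square[of x "- y"] by (simp add: cinner_minus_right)
    ultimately show ?thesis
      using m_le[of "(1/2) *\<^sub>R (x + y)"] by (simp add: J_def)
  qed
  have "Cauchy X"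
  proof (rule metric_CauchyI)
    fix e :: real
    assume "e > 0"
    then obtain N where N: "1 / real (Suc N) < e\<^sup>2 / 4"
      using nat_approx_posE[of "e\<^sup>2 / 4"] by auto
    have tail: "J (X n) - m < e\<^sup>2 / 4" if "n \<ge> N" for n
    proof -
      have "1 / real (Suc n) \<le> 1 / real (Suc N)"
        using that by (simp add: field_simps)
      with X[of n] N show ?thesis
        by linarith
    qed
    have "dist (X i) (X j) < e" if "i \<ge> N" "j \<ge> N" for i j
    proof -
      have "(norm (X i - X j))\<^sup>2 < e\<^sup>2"
        using par[of "X i" "X j"] tail[OF that(1)] tail[OF that(2)] by linarith
      then show ?thesis
        using \<open>e > 0\<close> by (simp add: dist_norm power2_less_imp_less)
    qed
    then show "\<exists>M. \<forall>i\<ge>M. \<forall>j\<ge>M. dist (X i) (X j) < e"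
      by blast
  qed
  then obtain x0 where x0: "X \<longlonglongrightarrow> x0"
    using Cauchy_convergent convergent_def by blast
  have "(\<lambda>n. J (X n)) \<longlonglongrightarrow> J x0"
    unfolding J_def by (intro tendsto_intros bounded_linear.tendsto[OF cblinfun_bounded_linear] x0)
  moreover have "(\<lambda>n. m + 1 / real (Suc n)) \<longlonglongrightarrow> m + 0"
    by (intro tendsto_intros LIMSEQ_Suc lim_1_over_n)
  ultimately have "J x0 \<le> m + 0"
    using X by (intro LIMSEQ_le[of _ "J x0" _ "m + 0"]) (auto intro: less_imp_le)
  then have J_min: "J x0 \<le> J x" for x
    using m_le[of x] by simp
  \<comment> \<open>First-order condition: a nonzero slope \<open>2 * d\<close> of \<open>J\<close>
    at \<open>x0\<close> in direction \<open>y\<close> would allow a smaller value.\<close>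
  have Re_eq: "Re (cinner x0 y) = Re (f y)" for y
  proof (rule ccontr)
    assume ne: "Re (cinner x0 y) \<noteq> Re (f y)"
    define d where "d = Re (cinner x0 y) - Re (f y)"
    have quad: "0 \<le> 2 * t * d + t\<^sup>2 * (norm y)\<^sup>2" for t
      using J_min[of "x0 + t *\<^sub>R y"]
      by (simp add: J_def norm_add_square scaleR_scaleC cinner_scaleC_right norm_scaleC
          cblinfun_add_right cblinfun_scaleC_right scaleC_complex_def d_def algebra_simps)
    have "(norm y)\<^sup>2 + 1 > 0"
      by (simp add: add_nonneg_pos)
    \<comment> \<open>The step \<open>- d / c\<close> comes near the minimum of the quadratic, and
      the added 1 avoids a division by zero at \<open>y = 0\<close>.\<close>
    define c where "c = (norm y)\<^sup>2 + 1"
    have c: "c > 0" "(norm y)\<^sup>2 = c - 1"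
      by (simp_all add: c_def add_nonneg_pos)
    have "2 * (- d / c) * d + (- d / c)\<^sup>2 * (c - 1) = - (d\<^sup>2 / c) - d\<^sup>2 / c\<^sup>2"
      using c(1) by (simp add: field_simps power2_eq_square)
    moreover have "d\<^sup>2 / c > 0" "d\<^sup>2 / c\<^sup>2 > 0"
      using ne c(1) by (simp_all add: d_def)
    ultimately show False
      using quad[of "- d / c"] c(2) by simp
  qed
  \<comment> \<open>Replacing \<open>y\<close> by \<open>\<i> *\<^sub>C y\<close> turns the identity
    of real parts into one of imaginary parts.\<close>
  have "f y = cinner x0 y" for y
    using Re_eq[of y] Re_eq[of "\<i> *\<^sub>C y"]
    by (simp add: complex_eq_iff cinner_scaleC_right cblinfun_scaleC_right scaleC_complex_def)
  then show ?thesis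
    by blast
qed

text \<open>Riesz representation of \<open>bra x \<circ>\<^sub>C T\<close> yields the value of the
  adjoint at each \<open>x\<close>; uniqueness of the representing vector makes it linear. Pairing
  this value with itself gives the norm bound.\<close>

lemma adj_ex:
  fixes T :: "'a::chilbert_space operator"
  shows "\<exists>S :: 'a operator. \<forall>x y. cinner (S x) y = cinner x (T y)"
proof -
  have "\<exists>z. \<forall>y. (bra x \<circ>\<^sub>C T) y = cinner z y" for x
    by (rule Riesz_representation)
  then obtain s where s: "\<And>x y. cinner (s x) y = cinner x (T y)"
    by (simp, metis)
  have scale: "s (a *\<^sub>C x) = a *\<^sub>C s x" for a x
    by (rule cinner_left_eqI) (simp add: s cinner_scaleC_left)
  have "bounded_linear s"
  proof (rule bounded_linear_intro[where K = "norm T"])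
    show "s (x + y) = s x + s y" for x y
      by (rule cinner_left_eqI) (simp add: s cinner_add_left)
    show "s (r *\<^sub>R x) = r *\<^sub>R s x" for r x
      by (simp add: scaleR_scaleC scale)
    show "norm (s x) \<le> norm x * norm T" for x
    proof -
      have "cmod (cinner (s x) (s x)) \<le> norm x * norm (T (s x))"
        by (simp only: s Cauchy_Schwarz_cinner)
      also have "\<dots> \<le> norm x * (norm T * norm (s x))"
        by (intro mult_left_mono norm_cblinfun_apply) simp
      finally have "norm (s x) * norm (s x) \<le> (norm x * norm T) * norm (s x)"
        by (simp add: cinner_self_eq_norm norm_mult power2_eq_square mult.assoc)
      then show ?thesis
        by (cases "norm (s x) = 0") (auto simp: mult_le_cancel_right)
    qed
  qed
  then have "cblinfun_apply (CBlinfun s) = s"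
    by (simp add: CBlinfun_inverse scale)
  then show ?thesis
    using s by metis
qed

text \<open>The choice is harmless: the defining identity determines the operator, as
  \<open>adj_eqI\<close> shows.\<close>

definition adj :: "'a::chilbert_space operator \<Rightarrow> 'a operator"
  where "adj T = (SOME S. \<forall>x y. cinner (cblinfun_apply S x) y = cinner x (T y))"

lemma cinner_adj_left: "cinner (cblinfun_apply (adj T) x) y = cinner x (T y)"
  using someI_ex[OF adj_ex[of T]] by (simp add: adj_def)

lemma cinner_adj_right: "cinner x (cblinfun_apply (adj T) y) = cinner (T x) y"
  by (metis cinner_adj_left cinner_commute)

lemma adj_eqI:
  assumes "\<And>x y. cinner (cblinfun_apply S x) y = cinner x (cblinfun_apply T y)"
  shows "adj T = S"
  by (rule cblinfun_eqI, rule cinner_left_eqI) (simp add: cinner_adj_left assms)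

lemma adj_adj [simp]: "adj (adj T) = T"
  by (rule adj_eqI) (simp add: cinner_adj_right)

lemma adj_add: "adj (S + T) = adj S + adj T"
  by (rule adj_eqI) (simp add: cinner_add_left cinner_add_right cinner_adj_left)

lemma adj_scaleC: "adj (a *\<^sub>C T) = cnj a *\<^sub>C adj T"
  by (rule adj_eqI) (simp add: cinner_scaleC_left cinner_scaleC_right cinner_adj_left)

lemma adj_selfadjoint: "selfadjoint T \<Longrightarrow> adj T = T"
  by (rule adj_eqI) (simp add: selfadjoint_def)

lemma norm_adj_le: "norm (adj T) \<le> norm T"
proof (rule norm_cblinfun_bound)
  show "norm (adj T x) \<le> norm T * norm x" for x
  proof -
    have "cmod (cinner (adj T x) (adj T x)) \<le> norm x * norm (T (adj T x))"
      by (simp only: cinner_adj_left Cauchy_Schwarz_cinner)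
    also have "\<dots> \<le> norm x * (norm T * norm (adj T x))"
      by (intro mult_left_mono norm_cblinfun_apply) simp
    finally have "norm (adj T x) * norm (adj T x) \<le> (norm T * norm x) * norm (adj T x)"
      by (simp add: cinner_self_eq_norm norm_mult power2_eq_square algebra_simps)
    then show ?thesis
      by (cases "norm (adj T x) = 0") (auto simp: mult_le_cancel_right)
  qed
qed simp


section \<open>Positive operators and projections\<close>

lemma positive_operatorD: "positive_operator T \<Longrightarrow> cinner x (T x) \<in> \<real>\<^sub>\<ge>\<^sub>0"
  by (simp add: positive_operator_def)

lemma operator_leD:
  "operator_le S T \<Longrightarrow> Re (cinner x (cblinfun_apply S x)) \<le> Re (cinner x (cblinfun_apply T x))"
  by (auto simp: operator_le_def positive_operator_def complex_nonneg_Reals_iff cinner_diff_right)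

lemma operator_le_trans:
  assumes "operator_le R S" "operator_le S T"
  shows "operator_le R T"
proof -
  have "cinner x ((T - S) x) + cinner x ((S - R) x) \<in> \<real>\<^sub>\<ge>\<^sub>0" for x
    using assms by (intro nonneg_Reals_add_I) (auto simp: operator_le_def positive_operator_def)
  then show ?thesis
    by (simp add: operator_le_def positive_operator_def flip: cinner_add_right)
qed

text \<open>Cauchy--Schwarz for the positive form \<open>cinner x (T y)\<close>, taken at
  \<open>T y\<close> and \<open>y\<close>, bounds the fourth power of \<open>norm (T y)\<close> by
  two values of the quadratic form. This avoids square roots of operators.\<close>

lemma positive_operator_norm_le:
  assumes "positive_operator T" "0 \<le> K" and le: "\<And>x. Re (cinner x (T x)) \<le> K * (norm x)\<^sup>2"
  shows "norm T \<le> K"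
proof (rule norm_cblinfun_bound[OF \<open>0 \<le> K\<close>])
  fix y
  have nonneg: "Re (cinner x (T x)) \<ge> 0" for x
    using positive_operatorD[OF assms(1), of x] by (simp add: complex_nonneg_Reals_iff)
  have "(cmod (cinner (T y) (T y)))\<^sup>2 \<le> Re (cinner (T y) (T (T y))) * Re (cinner y (T y))"
    by (rule sesquilinear_Cauchy_Schwarz[where B = "\<lambda>x y. cinner x (T y)"])
      (simp_all add: cinner_add_left cinner_add_right cinner_scaleC_left cinner_scaleC_right
        cblinfun_add_right cblinfun_scaleC_right positive_operatorD[OF assms(1)])
  also have "\<dots> \<le> (K * (norm (T y))\<^sup>2) * (K * (norm y)\<^sup>2)"
    using nonneg \<open>0 \<le> K\<close> by (intro mult_mono le) auto
  finally have "(norm (T y))\<^sup>2 * (norm (T y))\<^sup>2 \<le> (norm (T y))\<^sup>2 * (K * norm y)\<^sup>2"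
    by (simp add: cinner_self_eq_norm norm_mult power2_eq_square algebra_simps)
  then have "(norm (T y))\<^sup>2 \<le> (K * norm y)\<^sup>2" if "T y \<noteq> 0"
    by (rule mult_left_le_imp_le) (simp add: that)
  then have "(norm (T y))\<^sup>2 \<le> (K * norm y)\<^sup>2"
    by (cases "T y = 0") auto
  then show "norm (T y) \<le> K * norm y"
    by (rule power2_le_imp_le) (simp add: \<open>0 \<le> K\<close>)
qed

text \<open>Since 0 \<le> \<open>X - T\<close> \<le> \<open>X - S\<close>, the quadratic form of the
  positive operator \<open>X - T\<close> is bounded by \<open>norm (X - S)\<close>.\<close>

lemma norm_diff_operator_le:
  assumes "operator_le S T" "operator_le T X"
  shows "norm (X - T) \<le> norm (X - S)"
proof (rule positive_operator_norm_le)
  show "Re (cinner x ((X - T) x)) \<le> norm (X - S) * (norm x)\<^sup>2" for x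
  proof -
    have "Re (cinner x ((X - T) x)) \<le> Re (cinner x ((X - S) x))"
      using operator_leD[OF assms(1), of x] by (simp add: cinner_diff_right)
    also have "\<dots> \<le> norm x * norm ((X - S) x)"
      using Cauchy_Schwarz_cinner complex_Re_le_cmod order_trans by blast
    also have "\<dots> \<le> norm x * (norm (X - S) * norm x)"
      by (intro mult_left_mono norm_cblinfun_apply) simp
    finally show ?thesis
      by (simp add: power2_eq_square mult.commute mult.left_commute)
  qed
qed (use assms in \<open>simp_all add: operator_le_def\<close>)

section \<open>Projections and finite frames\<close>

lemma projection_id: "projection id_operator"
  by (simp add: projection_def selfadjoint_def)

lemma projection_complement: "projection p \<Longrightarrow> projection (id_operator - p)"
  by (simp add: projection_def selfadjoint_def cinner_diff_left cinner_diff_right cblinfun_diff_right)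

lemma projection_idem: "projection p \<Longrightarrow> p \<circ>\<^sub>C p = p"
  by (rule cblinfun_eqI) (simp add: projection_def)

lemma projection_cinner:
  assumes "projection p"
  shows "cinner x (p x) = complex_of_real ((norm (p x))\<^sup>2)"
proof -
  have "cinner (p x) (p x) = cinner x (p (p x))"
    using assms unfolding projection_def selfadjoint_def by blast
  then show ?thesis
    using assms by (simp add: projection_def cinner_self_eq_norm)
qed

lemma projection_positive: "projection p \<Longrightarrow> positive_operator p"
  by (simp add: positive_operator_def projection_cinner flip: of_real_power)

lemma norm_projection_le:
  assumes "projection p"
  shows "norm p \<le> 1"
proof (rule norm_cblinfun_bound)
  show "norm (p x) \<le> 1 * norm x" for x
  proof -
    have "norm (p x) * norm (p x) \<le> norm x * norm (p x)"
      using Cauchy_Schwarz_cinner[of x "p x"]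
      by (simp add: projection_cinner[OF assms] norm_power power2_eq_square norm_mult)
    then show ?thesis
      by (cases "norm (p x) = 0") (auto simp: mult_le_cancel_right)
  qed
qed simp

text \<open>Passing to adjoints in \<open>q p = p\<close> gives \<open>p q = p\<close>, so
  \<open>q - p\<close> is itself a projection and hence positive.\<close>

lemma projection_le:
  assumes p: "projection p" and q: "projection q" and qp: "\<And>x. q (p x) = p x"
  shows "operator_le p q"
proof -
  have "p (q x) = p x" for x
  proof (rule cinner_left_eqI)
    show "cinner (p (q x)) z = cinner (p x) z" for z
      using p q qp by (simp add: projection_def selfadjoint_def)
  qed
  then have "projection (q - p)"
    using p q qp
    by (simp add: projection_def selfadjoint_def cinner_diff_left cinner_diff_right cblinfun_diff_right)
  then show ?thesis
    unfolding operator_le_def by (rule projection_positive)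
qed

lemma finite_dim_projection_frame:
  fixes n :: nat
  assumes q: "projection q" and frame: "q = (\<Sum>i<n. ketbra (e i) (e i))"
  shows "finite_dim_projection q"
proof -
  have "range q = complex_vector.span ((\<lambda>i. q (e i)) ` {..<n})"
  proof
    show "range q \<subseteq> complex_vector.span ((\<lambda>i. q (e i)) ` {..<n})"
    proof
      fix y
      assume "y \<in> range q"
      then have "y = q y"
        using q by (auto simp: projection_def)
      \<comment> \<open>Only the inner \<open>q\<close> is expanded by the frame; the outer one then
        sends each \<open>e i\<close> into the range.\<close>
      also have "\<dots> = q (q y)"
        using q by (simp add: projection_def)
      also have "\<dots> = q (\<Sum>i<n. cinner (e i) y *\<^sub>C e i)"
        by (subst (2) frame) simp
      also have "\<dots> = (\<Sum>i<n. cinner (e i) y *\<^sub>C q (e i))"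
        by (simp add: cblinfun_sum_right cblinfun_scaleC_right)
      finally show "y \<in> complex_vector.span ((\<lambda>i. q (e i)) ` {..<n})"
        by (metis (no_types, lifting) complex_vector.span_base complex_vector.span_scale
            complex_vector.span_sum imageI)
    qed
    show "complex_vector.span ((\<lambda>i. q (e i)) ` {..<n}) \<subseteq> range q"
    proof (rule complex_vector.span_minimal)
      show "complex_vector.subspace (range q)"
        unfolding complex_vector.subspace_def
        by (auto simp flip: cblinfun_add_right cblinfun_scaleC_right)
          (metis cblinfun_zero_right rangeI)
    qed auto
  qed
  then show ?thesis
    using q unfolding finite_dim_projection_def by blast
qed

text \<open>Gram--Schmidt, starting from the empty sum, the zero projection. The vectors are kept
  explicit because compressions are later expanded in the operators
  \<open>ketbra (e i) (e j)\<close>.\<close>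

lemma projection_frame_fixing_finite:
  assumes "finite F"
  shows "\<exists>(n::nat) e. projection (\<Sum>i<n. ketbra (e i) (e i)) \<and>
    (\<forall>v\<in>F. (\<Sum>i<n. ketbra (e i) (e i)) v = v)"
  using assms
proof induction
  case empty
  have "projection (\<Sum>i<0::nat. ketbra (e i) (e i))" for e :: "nat \<Rightarrow> 'a"
    by (simp add: projection_def selfadjoint_def)
  then show ?case
    by blast
next
  case (insert v F)
  then obtain n :: nat and e where
    proj: "projection (\<Sum>i<n. ketbra (e i) (e i))" and
    fixes_F: "\<forall>v\<in>F. (\<Sum>i<n. ketbra (e i) (e i)) v = v"
    by blast
  define q where "q = (\<Sum>i<n. ketbra (e i) (e i))"
  have q: "projection q" and qF: "\<forall>v\<in>F. q v = v"
    using proj fixes_F unfolding q_def by blast+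
  have q_idem: "q (q x) = q x" and q_sa: "cinner (q x) y = cinner x (q y)" for x y
    using q by (auto simp: projection_def selfadjoint_def)
  define w where "w = v - q v"
  show ?case
  proof (cases "w = 0")
    case True
    then have "\<forall>x\<in>insert v F. q x = x"
      using qF by (simp add: w_def)
    with q show ?thesis
      unfolding q_def by blast
  next
    case False
    \<comment> \<open>The normalised residual of \<open>v\<close> is orthogonal to the range of
      \<open>q\<close>, so all cross terms vanish when \<open>ketbra u u\<close> is added.\<close>
    define u where "u = inverse (norm w) *\<^sub>C w"
    have qw: "q w = 0"
      by (simp add: w_def cblinfun_diff_right q_idem)
    have qu: "q u = 0"
      by (simp add: u_def cblinfun_scaleC_right qw)
    have norm_u: "norm u = 1"
      using False by (simp add: u_def norm_scaleC norm_inverse)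
    then have uu: "cinner u u = 1"
      by (simp add: cinner_self_eq_norm)
    have uq: "cinner u (q x) = 0" for x
      using q_sa[of u x] by (simp add: qu)
    define e' where "e' = e(n := u)"
    have frame: "(\<Sum>i<Suc n. ketbra (e' i) (e' i)) = q + ketbra u u"
      by (simp add: e'_def q_def)
    have sa: "cnj (cinner u x) * cinner u y = cinner x u * cinner u y" for x y
      by (metis cinner_commute)
    have "projection (q + ketbra u u)"
      using sa unfolding projection_def selfadjoint_def
      by (simp add: q_sa q_idem uq uu qu cinner_add_left cinner_add_right cinner_scaleC_left
          cinner_scaleC_right cblinfun_add_right cblinfun_scaleC_right mult.commute)
    moreover have "(q + ketbra u u) x = x" if "x \<in> insert v F" for x
    proof (cases "x \<in> F")
      case True
      then show ?thesis
        using qF uq[of x] by simp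
    next
      case False
      then have x: "x = v"
        using that by simp
      \<comment> \<open>The new rank-one term maps \<open>v\<close> to its residual
        \<open>w\<close>, which restores \<open>q v + w = v\<close>.\<close>
      have "cinner u v = cinner u w"
        by (simp add: w_def cinner_diff_right uq)
      also have "\<dots> = norm w"
        using \<open>w \<noteq> 0\<close> by (simp add: u_def cinner_scaleC_left cinner_self_eq_norm power2_eq_square)
      finally have "cinner u v *\<^sub>C u = w"
        using \<open>w \<noteq> 0\<close> by (simp add: u_def scaleC_scaleC)
      then show ?thesis
        by (simp add: x w_def)
    qed
    ultimately show ?thesis
      unfolding frame[symmetric] by blast
  qed
qed

text \<open>A frame projection fixing finite spanning sets of all the ranges fixes the ranges, and
  so dominates every \<open>p\<close>.\<close>

lemma finite_dim_projections_dominated: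
  assumes "finite P" "\<And>p. p \<in> P \<Longrightarrow> finite_dim_projection p"
  shows "\<exists>(n::nat) e. projection (\<Sum>i<n. ketbra (e i) (e i)) \<and>
    (\<forall>p\<in>P. operator_le p (\<Sum>i<n. ketbra (e i) (e i)))"
proof -
  have "\<forall>p\<in>P. \<exists>B. finite B \<and> range (cblinfun_apply p) = complex_vector.span B"
    using assms(2) by (auto simp: finite_dim_projection_def)
  then obtain B where B:
    "\<And>p. p \<in> P \<Longrightarrow> finite (B p) \<and> range (cblinfun_apply p) = complex_vector.span (B p)"
    by metis
  have "finite (\<Union>p\<in>P. B p)"
    using assms(1) B by blast
  from projection_frame_fixing_finite[OF this] obtain n :: nat and e where
    proj: "projection (\<Sum>i<n. ketbra (e i) (e i))" and
    fixes_B: "\<forall>v\<in>(\<Union>p\<in>P. B p). (\<Sum>i<n. ketbra (e i) (e i)) v = v"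
    by blast
  define q where "q = (\<Sum>i<n. ketbra (e i) (e i))"
  have q: "projection q" and qB: "\<forall>v\<in>(\<Union>p\<in>P. B p). q v = v"
    using proj fixes_B unfolding q_def by blast+
  have "operator_le p q" if "p \<in> P" for p
  proof (rule projection_le[OF _ q])
    show "projection p"
      using assms(2)[OF that] by (simp add: finite_dim_projection_def)
    have "complex_vector.subspace {v. q v = v}"
      by (simp add: complex_vector.subspace_def cblinfun_add_right cblinfun_scaleC_right)
    then have "complex_vector.span (B p) \<subseteq> {v. q v = v}"
      using qB that by (intro complex_vector.span_minimal) auto
    then show "q (p x) = p x" for x
      using B[OF that] by blast
  qed
  with proj show ?thesis
    unfolding q_def by blast
qed

section \<open>The directed set of finite dimensional projections\<close>

lemma operator_directed_finite_dim_projections: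
  "operator_directed {p :: 'a::complex_inner operator. finite_dim_projection p}"
  unfolding operator_directed_def
proof (intro conjI ballI)
  show "{p :: 'a operator. finite_dim_projection p} \<noteq> {}"
    using projection_frame_fixing_finite[of "{} :: 'a set"] finite_dim_projection_frame by blast
  fix S T :: "'a operator"
  assume "S \<in> {p. finite_dim_projection p}" "T \<in> {p. finite_dim_projection p}"
  then have "\<And>p. p \<in> {S, T} \<Longrightarrow> finite_dim_projection p"
    by auto
  from finite_dim_projections_dominated[OF finite.insertI[OF finite.insertI[OF finite.emptyI]] this]
  obtain n :: nat and e where "projection (\<Sum>i<n. ketbra (e i) (e i))"
    "\<forall>p\<in>{S, T}. operator_le p (\<Sum>i<n. ketbra (e i) (e i))"
    by blast
  then show "\<exists>U\<in>{p. finite_dim_projection p}. operator_le S U \<and> operator_le T U"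
    using finite_dim_projection_frame by blast
qed

text \<open>An upper bound \<open>Y\<close> is compared with the identity one vector at a time: at
  \<open>x\<close>, a finite dimensional projection fixing \<open>x\<close> already acts as the
  identity.\<close>

lemma operator_lub_finite_dim_projections:
  "operator_lub {p :: 'a::complex_inner operator. finite_dim_projection p} id_operator"
  unfolding operator_lub_def
proof (intro conjI ballI allI impI)
  show "operator_le p id_operator" if "p \<in> {p. finite_dim_projection p}" for p :: "'a operator"
    using that by (intro projection_le projection_id) (simp_all add: finite_dim_projection_def)
  fix Y :: "'a operator"
  assume Y: "\<forall>p\<in>{p. finite_dim_projection p}. operator_le p Y"
  show "operator_le id_operator Y"
    unfolding operator_le_def positive_operator_def
  proof
    fix x :: 'a
    from projection_frame_fixing_finite[of "{x}"] obtain n :: nat and e where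
      "projection (\<Sum>i<n. ketbra (e i) (e i))" and x: "(\<Sum>i<n. ketbra (e i) (e i)) x = x"
      by blast
    then have "operator_le (\<Sum>i<n. ketbra (e i) (e i)) Y"
      using Y finite_dim_projection_frame by blast
    then have "cinner x ((Y - (\<Sum>i<n. ketbra (e i) (e i))) x) \<in> \<real>\<^sub>\<ge>\<^sub>0"
      unfolding operator_le_def by (rule positive_operatorD)
    then show "cinner x ((Y - id_operator) x) \<in> \<real>\<^sub>\<ge>\<^sub>0"
      using x by simp
  qed
qed


section \<open>Normal functionals and states\<close>

text \<open>
  Functionals may be estimated on a tail of the directed set only, where it is norm bounded: for
  \<open>S \<le> T \<le> X\<close> one has \<open>\<parallel>X - T\<parallel> \<le> \<parallel>X - S\<parallel>\<close>.
\<close>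

lemma closed_normal_functional:
  "closed {\<phi> :: 'a::complex_inner functional. normal_functional \<phi>}"
proof -
  have "normal_functional \<phi>" if \<phi>: "\<phi> \<in> closure {\<phi>. normal_functional \<phi>}"
    for \<phi> :: "'a functional"
    unfolding normal_functional_def
  proof (intro allI impI, elim conjE)
    fix D :: "'a operator set" and X and e :: real
    assume D: "\<forall>T\<in>D. selfadjoint T" "operator_directed D" "operator_lub D X" and "0 < e"
    then obtain S0 where S0: "S0 \<in> D"
      by (auto simp: operator_directed_def)
    \<comment> \<open>This bounds \<open>norm (X - T)\<close> for all \<open>T\<close> in
      \<open>D\<close> above \<open>S0\<close>; the added 1 allows division by it.\<close>
    define K where "K = norm (X - S0) + 1"
    have "K > 0"
      by (simp add: K_def add_nonneg_pos)
    then have "e / (2 * K) > 0"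
      using \<open>0 < e\<close> by simp
    then obtain \<psi> where \<psi>: "normal_functional \<psi>" "dist \<psi> \<phi> < e / (2 * K)"
      using \<phi> unfolding closure_approachable by blast
    have "e / 2 > 0"
      using \<open>0 < e\<close> by simp
    then obtain S1 where S1: "S1 \<in> D"
      "\<And>T. T \<in> D \<Longrightarrow> operator_le S1 T \<Longrightarrow> cmod (\<psi> T - \<psi> X) < e / 2"
      using \<psi>(1) D unfolding normal_functional_def by blast
    \<comment> \<open>Above \<open>S0\<close> the norm bound \<open>K\<close> holds, above
      \<open>S1\<close> the estimate for \<psi>; directedness provides both at once.\<close>
    obtain U where U: "U \<in> D" "operator_le S0 U" "operator_le S1 U"
      using D(2) S0 S1(1) unfolding operator_directed_def by blast
    show "\<exists>S\<in>D. \<forall>T\<in>D. operator_le S T \<longrightarrow> cmod (\<phi> T - \<phi> X) < e"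
    proof (intro bexI[OF _ U(1)] ballI impI)
      fix T
      assume T: "T \<in> D" "operator_le U T"
      have "operator_le T X"
        using D(3) T(1) by (simp add: operator_lub_def)
      then have "norm (X - T) \<le> K"
        using norm_diff_operator_le[OF operator_le_trans[OF U(2) T(2)], of X] by (simp add: K_def)
      then have "norm (\<psi> - \<phi>) * norm (X - T) \<le> e / (2 * K) * K"
        using \<psi>(2) \<open>K > 0\<close> \<open>0 < e\<close> by (intro mult_mono) (simp_all add: dist_norm less_imp_le)
      also have "\<dots> = e / 2"
        using \<open>K > 0\<close> by simp
      finally have "cmod ((\<psi> - \<phi>) (X - T)) \<le> e / 2"
        using norm_cblinfun_apply[of "\<psi> - \<phi>" "X - T"] by linarith
      moreover have "cmod (\<psi> T - \<psi> X) < e / 2"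
        using S1(2)[OF T(1) operator_le_trans[OF U(3) T(2)]] .
      moreover have eq: "\<phi> T - \<phi> X = (\<psi> T - \<psi> X) + (\<psi> - \<phi>) (X - T)"
        by (simp add: cblinfun_diff_right)
      ultimately show "cmod (\<phi> T - \<phi> X) < e"
        unfolding eq using norm_triangle_ineq[of "\<psi> T - \<psi> X" "(\<psi> - \<phi>) (X - T)"] by linarith
    qed
  qed
  then show ?thesis
    using closure_subset_eq by blast
qed

section \<open>Order and norm estimates for states\<close>

lemma adj_comp_self_positive: "positive_operator (adj T \<circ>\<^sub>C T)"
  by (simp add: positive_operator_def cinner_adj_right cinner_self_eq_norm flip: of_real_power)

lemma state_mono:
  assumes "state \<phi>" "operator_le S T"
  shows "Re (\<phi> S) \<le> Re (\<phi> T)"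
proof -
  have "\<phi> (T - S) \<in> \<real>\<^sub>\<ge>\<^sub>0"
    using assms by (simp add: state_def operator_le_def)
  then show ?thesis
    by (simp add: cblinfun_diff_right complex_nonneg_Reals_iff)
qed

text \<open>The operator \<open>adj T \<circ>\<^sub>C T\<close> lies below the square of
  \<open>norm T\<close> times the identity, where a state takes the value of that scalar.\<close>

lemma state_adj_comp_self_le:
  assumes "state \<phi>"
  shows "Re (\<phi> (adj T \<circ>\<^sub>C T)) \<le> (norm T)\<^sup>2"
proof -
  have "operator_le (adj T \<circ>\<^sub>C T) (complex_of_real ((norm T)\<^sup>2) *\<^sub>C id_operator)"
    unfolding operator_le_def positive_operator_def
  proof
    fix x
    have "(norm (T x))\<^sup>2 \<le> (norm T)\<^sup>2 * (norm x)\<^sup>2"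
      using power_mono[OF norm_cblinfun_apply[of T x], of 2] by (simp add: power_mult_distrib)
    then show "cinner x ((complex_of_real ((norm T)\<^sup>2) *\<^sub>C id_operator - (adj T \<circ>\<^sub>C T)) x) \<in> \<real>\<^sub>\<ge>\<^sub>0"
      by (simp add: cinner_diff_right cinner_scaleC_right cinner_adj_right cinner_self_eq_norm
          complex_nonneg_Reals_iff flip: of_real_power)
  qed
  from state_mono[OF assms this] show ?thesis
    using assms by (simp add: cblinfun_scaleC_right scaleC_complex_def state_def flip: of_real_power)
qed

lemma state_Cauchy_Schwarz:
  assumes "state \<phi>"
  shows "cmod (\<phi> (adj S \<circ>\<^sub>C T)) \<le> sqrt (Re (\<phi> (adj S \<circ>\<^sub>C S))) * sqrt (Re (\<phi> (adj T \<circ>\<^sub>C T)))"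
proof -
  have "(cmod (\<phi> (adj S \<circ>\<^sub>C T)))\<^sup>2 \<le> Re (\<phi> (adj S \<circ>\<^sub>C S)) * Re (\<phi> (adj T \<circ>\<^sub>C T))"
    using assms
    by (intro sesquilinear_Cauchy_Schwarz[where B = "\<lambda>S T. \<phi> (adj S \<circ>\<^sub>C T)"])
      (simp_all add: adj_add adj_scaleC cblinfun_comp_add_left cblinfun_comp_add_right
        cblinfun_comp_scaleC_left cblinfun_comp_scaleC_right cblinfun_add_right
        cblinfun_scaleC_right scaleC_complex_def state_def adj_comp_self_positive)
  then show ?thesis
    by (metis real_le_rsqrt real_sqrt_mult)
qed

text \<open>Cauchy--Schwarz against the identity. It bounds the coefficients of all states
  uniformly.\<close>

lemma cmod_state_le:
  fixes \<phi> :: "'a::chilbert_space functional"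
  assumes "state \<phi>"
  shows "cmod (\<phi> T) \<le> norm T"
proof -
  have "adj id_operator = (id_operator :: 'a operator)"
    by (rule adj_eqI) simp
  moreover have "id_operator \<circ>\<^sub>C S = S" for S :: "'a operator"
    by (rule cblinfun_eqI) simp
  ultimately have "cmod (\<phi> T) \<le> sqrt (Re (\<phi> (adj T \<circ>\<^sub>C T)))"
    using state_Cauchy_Schwarz[OF assms, of id_operator T] assms by (simp add: state_def)
  also have "\<dots> \<le> norm T"
    using state_adj_comp_self_le[OF assms, of T] by (simp add: real_le_lsqrt)
  finally show ?thesis .
qed

text \<open>Both off-diagonal parts \<open>(1 - q) T\<close> and \<open>q T (1 - q)\<close> are controlled by \<open>\<phi> (1 - q)\<close>.\<close>

lemma state_compression:
  fixes \<phi> :: "'a::chilbert_space functional"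
  assumes \<phi>: "state \<phi>" and q: "projection q"
  shows "cmod (\<phi> T - \<phi> (q \<circ>\<^sub>C T \<circ>\<^sub>C q)) \<le> 2 * sqrt (1 - Re (\<phi> q)) * norm T"
proof -
  define r where "r = id_operator - q"
  have r: "projection r"
    unfolding r_def by (rule projection_complement[OF q])
  then have adj_r: "adj r = r"
    by (simp add: adj_selfadjoint projection_def)
  have rr: "r \<circ>\<^sub>C r = r"
    by (rule projection_idem[OF r])
  have \<phi>r: "Re (\<phi> r) = 1 - Re (\<phi> q)"
    using \<phi> by (simp add: r_def cblinfun_diff_right state_def)
  have \<phi>r_nonneg: "Re (\<phi> r) \<ge> 0"
    using \<phi> projection_positive[OF r] by (auto simp: state_def complex_nonneg_Reals_iff)
  have le: "sqrt (Re (\<phi> (adj S \<circ>\<^sub>C S))) \<le> norm S" for S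
    using state_adj_comp_self_le[OF \<phi>, of S] by (simp add: real_le_lsqrt)
  have "cmod (\<phi> (r \<circ>\<^sub>C T)) \<le> sqrt (Re (\<phi> r)) * sqrt (Re (\<phi> (adj T \<circ>\<^sub>C T)))"
    using state_Cauchy_Schwarz[OF \<phi>, of r T] by (simp add: adj_r rr)
  also have "\<dots> \<le> sqrt (Re (\<phi> r)) * norm T"
    using le \<phi>r_nonneg by (intro mult_left_mono) auto
  finally have 1: "cmod (\<phi> (r \<circ>\<^sub>C T)) \<le> sqrt (Re (\<phi> r)) * norm T" .
  \<comment> \<open>With this choice \<open>adj ?S \<circ>\<^sub>C r\<close> is
    \<open>q T r\<close>, and its Cauchy--Schwarz bound again has the factor
    \<open>sqrt (Re (\<phi> r))\<close>.\<close>
  let ?S = "adj (q \<circ>\<^sub>C T)"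
  have "norm ?S \<le> norm (q \<circ>\<^sub>C T)"
    by (rule norm_adj_le)
  also have "\<dots> \<le> norm q * norm T"
    by (rule norm_cblinfun_comp)
  also have "\<dots> \<le> 1 * norm T"
    by (intro mult_right_mono norm_projection_le[OF q]) simp
  finally have "norm ?S \<le> norm T"
    by simp
  then have "sqrt (Re (\<phi> (adj ?S \<circ>\<^sub>C ?S))) \<le> norm T"
    using le[of ?S] by linarith
  then have "sqrt (Re (\<phi> (adj ?S \<circ>\<^sub>C ?S))) * sqrt (Re (\<phi> r)) \<le> norm T * sqrt (Re (\<phi> r))"
    using \<phi>r_nonneg by (intro mult_right_mono) auto
  then have 2: "cmod (\<phi> (q \<circ>\<^sub>C T \<circ>\<^sub>C r)) \<le> norm T * sqrt (Re (\<phi> r))"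
    using state_Cauchy_Schwarz[OF \<phi>, of ?S r] by (simp add: adj_r rr)
  have "T - q \<circ>\<^sub>C T \<circ>\<^sub>C q = r \<circ>\<^sub>C T + q \<circ>\<^sub>C T \<circ>\<^sub>C r"
    by (rule cblinfun_eqI) (simp add: r_def cblinfun_diff_right)
  then have "\<phi> T - \<phi> (q \<circ>\<^sub>C T \<circ>\<^sub>C q) = \<phi> (r \<circ>\<^sub>C T) + \<phi> (q \<circ>\<^sub>C T \<circ>\<^sub>C r)"
    by (metis cblinfun_add_right cblinfun_diff_right)
  then show ?thesis
    using norm_triangle_ineq[of "\<phi> (r \<circ>\<^sub>C T)" "\<phi> (q \<circ>\<^sub>C T \<circ>\<^sub>C r)"] 1 2
    by (simp add: \<phi>r algebra_simps)
qed

section \<open>Compressions as combinations of matrix coefficients\<close>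

lift_definition matrix_coefficient :: "'a::complex_inner \<Rightarrow> 'a \<Rightarrow> 'a functional"
  is "\<lambda>x y T. cinner x (cblinfun_apply T y)"
proof (intro conjI allI)
  fix x y :: 'a
  show "bounded_linear (\<lambda>T :: 'a operator. cinner x (T y))"
  proof (rule bounded_linear_intro[where K = "norm x * norm y"])
    show "norm (cinner x (T y)) \<le> norm T * (norm x * norm y)" for T :: "'a operator"
      using Cauchy_Schwarz_cinner[of x "T y"]
        mult_left_mono[OF norm_cblinfun_apply[of T y], of "norm x"]
      by (simp add: mult.commute mult.left_commute)
  qed (simp_all add: cinner_add_right scaleR_scaleC cinner_scaleC_right scaleC_complex_def)
  show "cinner x ((a *\<^sub>C T) y) = a *\<^sub>C cinner x (T y)" for a and T :: "'a operator"
    by (simp add: cinner_scaleC_right scaleC_complex_def)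
qed

declare matrix_coefficient.rep_eq [simp]

text \<open>Expanding both factors \<open>q\<close> by the frame shows that the compression depends
  on \<phi> only through its finitely many values on the \<open>ketbra (e i) (e j)\<close>.\<close>

lemma frame_compression:
  fixes \<phi> :: "'a::complex_inner functional"
  assumes "q = (\<Sum>i<n. ketbra (e i) (e i))"
  shows "\<phi> (q \<circ>\<^sub>C T \<circ>\<^sub>C q) =
    (\<Sum>(i, j)\<in>{..<n::nat} \<times> {..<n}. \<phi> (ketbra (e i) (e j)) *\<^sub>C matrix_coefficient (e i) (e j)) T"
    (is "_ = cblinfun_apply ?R T")
proof -
  have "q \<circ>\<^sub>C T \<circ>\<^sub>C q = (\<Sum>i<n. \<Sum>j<n. cinner (e i) (T (e j)) *\<^sub>C ketbra (e i) (e j))"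
    by (rule cblinfun_eqI)
      (simp add: assms cblinfun_sum_right cblinfun_scaleC_right cinner_sum_right cinner_scaleC_right
        complex_vector.scale_sum_left scaleC_scaleC mult.commute)
  then have "\<phi> (q \<circ>\<^sub>C T \<circ>\<^sub>C q) = (\<Sum>i<n. \<Sum>j<n. \<phi> (ketbra (e i) (e j)) * cinner (e i) (T (e j)))"
    by (simp add: cblinfun_sum_right cblinfun_scaleC_right scaleC_complex_def mult.commute)
  then show ?thesis
    by (simp add: sum.cartesian_product case_prod_beta scaleC_complex_def)
qed

text \<open>Each new vector contributes the continuous image of a closed disc, and sums of two
  compact sets are compact.\<close>

lemma compact_bounded_combinations:
  fixes v :: "'i \<Rightarrow> 'b::complex_normed_vector"
  assumes "finite I"
  shows "compact {\<Sum>i\<in>I. c i *\<^sub>C v i | c. \<forall>i\<in>I. cmod (c i) \<le> M}"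
  using assms
proof induction
  case empty
  then show ?case
    by simp
next
  case (insert k I)
  let ?K = "{\<Sum>i\<in>I. c i *\<^sub>C v i | c. \<forall>i\<in>I. cmod (c i) \<le> M}"
  have "compact ((\<lambda>c. c *\<^sub>C v k) ` cball 0 M)"
    by (intro compact_continuous_image linear_continuous_on bounded_linear_scaleC_left compact_cball)
  then have "compact {x + y | x y. x \<in> (\<lambda>c. c *\<^sub>C v k) ` cball 0 M \<and> y \<in> ?K}"
    using insert.IH by (rule compact_sums)
  also have "{x + y | x y. x \<in> (\<lambda>c. c *\<^sub>C v k) ` cball 0 M \<and> y \<in> ?K} =
    {\<Sum>i\<in>insert k I. c i *\<^sub>C v i | c. \<forall>i\<in>insert k I. cmod (c i) \<le> M}" (is "?A = ?B")
  proof
    show "?A \<subseteq> ?B"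
    proof
      fix z
      assume "z \<in> ?A"
      then obtain a c where *: "cmod a \<le> M" "\<forall>i\<in>I. cmod (c i) \<le> M"
        "z = a *\<^sub>C v k + (\<Sum>i\<in>I. c i *\<^sub>C v i)"
        by auto
      have "(\<Sum>i\<in>I. (c(k := a)) i *\<^sub>C v i) = (\<Sum>i\<in>I. c i *\<^sub>C v i)"
        using insert.hyps by (intro sum.cong) auto
      then have "z = (\<Sum>i\<in>insert k I. (c(k := a)) i *\<^sub>C v i)"
        using insert.hyps *(3) by simp
      moreover have "\<forall>i\<in>insert k I. cmod ((c(k := a)) i) \<le> M"
        using * by simp
      ultimately show "z \<in> ?B"
        by blast
    qed
    show "?B \<subseteq> ?A"
      using insert.hyps by fastforce
  qed
  finally show ?case .
qed


section \<open>Tightness and total boundedness\<close>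

lemma tight_imp_compact_closure:
  fixes \<theta> :: "nat \<Rightarrow> 'a::chilbert_space functional"
  assumes \<theta>: "\<And>n. state (\<theta> n)" and "tight \<theta>"
  shows "compact (closure (range \<theta>))"
proof -
  have cover: "\<exists>k. finite k \<and> closure (range \<theta>) \<subseteq> (\<Union>x\<in>k. ball x \<epsilon>)" if "\<epsilon> > 0" for \<epsilon>
  proof -
    \<comment> \<open>The compression costs \<open>2 * \<delta>\<close> and the finite net of
      \<open>C\<close> another \<open>\<delta>\<close>; the total stays below \<epsilon>.\<close>
    define \<delta> where "\<delta> = \<epsilon> / 8"
    have "\<delta> > 0"
      using that by (simp add: \<delta>_def)
    \<comment> \<open>The square compensates the square root in
      \<open>state_compression\<close>.\<close>
    then obtain p where p: "finite_dim_projection p" "\<And>n. Re (\<theta> n p) > 1 - \<delta>\<^sup>2"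
      using \<open>tight \<theta>\<close> unfolding tight_def by (metis zero_less_power)
    \<comment> \<open>Exchange \<open>p\<close> for a larger projection with an explicit frame; by
      monotonicity of states the lower bound carries over.\<close>
    have "\<exists>(n::nat) e. projection (\<Sum>i<n. ketbra (e i) (e i)) \<and>
      (\<forall>p\<in>{p}. operator_le p (\<Sum>i<n. ketbra (e i) (e i)))"
      by (rule finite_dim_projections_dominated) (simp_all add: p(1))
    then obtain m :: nat and e where
      proj: "projection (\<Sum>i<m. ketbra (e i) (e i))" and
      le: "operator_le p (\<Sum>i<m. ketbra (e i) (e i))"
      by blast
    define q where "q = (\<Sum>i<m. ketbra (e i) (e i))"
    have q: "projection q" and pq: "operator_le p q"
      using proj le by (simp_all only: q_def)
    define I where "I = {..<m} \<times> {..<m}"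
    define c where "c n = (\<lambda>(i, j). \<theta> n (ketbra (e i) (e j)))" for n
    define v where "v = (\<lambda>(i, j). matrix_coefficient (e i) (e j))"
    \<comment> \<open>One bound for all coefficients, independent of \<open>n\<close>, so that a
      single compact set \<open>C\<close> contains every compression.\<close>
    define M where "M = (\<Sum>(i, j)\<in>I. norm (ketbra (e i) (e j)))"
    define C where "C = {\<Sum>i\<in>I. c i *\<^sub>C v i | c. \<forall>i\<in>I. cmod (c i) \<le> M}"
    have "finite I"
      by (simp add: I_def)
    then have "compact C"
      unfolding C_def by (rule compact_bounded_combinations)
    have "cmod (c n ij) \<le> M" if "ij \<in> I" for n ij
    proof -
      obtain i j where ij: "ij = (i, j)"
        by fastforce
      have "cmod (c n ij) \<le> norm (ketbra (e i) (e j))"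
        using cmod_state_le[OF \<theta>] by (simp add: c_def ij)
      also have "\<dots> \<le> M"
        unfolding M_def using \<open>finite I\<close> that ij
          member_le_sum[of ij I "\<lambda>(i, j). norm (ketbra (e i) (e j))"] by fastforce
      finally show ?thesis .
    qed
    then have in_C: "(\<Sum>ij\<in>I. c n ij *\<^sub>C v ij) \<in> C" for n
      unfolding C_def by blast
    have close: "dist (\<theta> n) (\<Sum>ij\<in>I. c n ij *\<^sub>C v ij) \<le> 2 * \<delta>" for n
      unfolding dist_norm
    proof (rule norm_cblinfun_bound)
      fix T
      have "(\<Sum>ij\<in>I. c n ij *\<^sub>C v ij) T = \<theta> n (q \<circ>\<^sub>C T \<circ>\<^sub>C q)"
        unfolding frame_compression[OF q_def] c_def v_def I_def by (simp add: case_prod_beta)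
      then have "norm ((\<theta> n - (\<Sum>ij\<in>I. c n ij *\<^sub>C v ij)) T) \<le> 2 * sqrt (1 - Re (\<theta> n q)) * norm T"
        using state_compression[OF \<theta> q] by simp
      also have "\<dots> \<le> 2 * \<delta> * norm T"
      proof -
        have "1 - Re (\<theta> n q) \<le> \<delta>\<^sup>2"
          using state_mono[OF \<theta> pq, of n] p(2)[of n] by linarith
        then have "sqrt (1 - Re (\<theta> n q)) \<le> \<delta>"
          using \<open>\<delta> > 0\<close> by (simp add: real_le_lsqrt)
        then show ?thesis
          by (intro mult_right_mono) auto
      qed
      finally show "norm ((\<theta> n - (\<Sum>ij\<in>I. c n ij *\<^sub>C v ij)) T) \<le> 2 * \<delta> * norm T" .
    qed (use \<open>\<delta> > 0\<close> in simp)
    obtain k where k: "finite k" "C \<subseteq> (\<Union>x\<in>k. ball x \<delta>)"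
      using \<open>compact C\<close> \<open>\<delta> > 0\<close> unfolding compact_eq_totally_bounded by blast
    \<comment> \<open>Closed balls make the finite union closed, so that it also covers the
      closure.\<close>
    have "range \<theta> \<subseteq> (\<Union>x\<in>k. cball x (3 * \<delta>))"
    proof
      fix \<phi>
      assume "\<phi> \<in> range \<theta>"
      then obtain n where n: "\<phi> = \<theta> n"
        by blast
      obtain x where x: "x \<in> k" "dist x (\<Sum>ij\<in>I. c n ij *\<^sub>C v ij) < \<delta>"
        using k(2) in_C[of n] by auto
      have "dist x \<phi> \<le> 3 * \<delta>"
        using dist_triangle2[of x \<phi> "\<Sum>ij\<in>I. c n ij *\<^sub>C v ij"] x(2) close[of n] unfolding n
        by linarith
      with x(1) show "\<phi> \<in> (\<Union>x\<in>k. cball x (3 * \<delta>))"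
        by auto
    qed
    moreover have "closed (\<Union>x\<in>k. cball x (3 * \<delta>))"
      using k(1) by (intro closed_UN) auto
    ultimately have "closure (range \<theta>) \<subseteq> (\<Union>x\<in>k. cball x (3 * \<delta>))"
      by (rule closure_minimal)
    also have "\<dots> \<subseteq> (\<Union>x\<in>k. ball x \<epsilon>)"
      using that by (intro UN_mono order_refl) (auto simp: \<delta>_def)
    finally show ?thesis
      using k(1) by blast
  qed
  moreover have "complete (closure (range \<theta>))"
    by (simp add: complete_eq_closed)
  ultimately show ?thesis
    unfolding compact_eq_totally_bounded by blast
qed

text \<open>Normality gives each centre of a finite net its own projection beyond which it is almost
  1 on the identity's scale; a common dominating projection then serves all centres, and norm
  closeness passes the estimate to every member of the sequence.\<close>

lemma compact_normal_imp_tight: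
  fixes \<theta> :: "nat \<Rightarrow> 'a::complex_inner functional"
  assumes \<theta>: "\<And>n. state (\<theta> n)" and "compact K"
    and normal: "\<And>\<phi>. \<phi> \<in> K \<Longrightarrow> normal_functional \<phi>" and "range \<theta> \<subseteq> K"
  shows "tight \<theta>"
  unfolding tight_def
proof (intro allI impI)
  fix \<epsilon> :: real
  assume "\<epsilon> > 0"
  define \<delta> where "\<delta> = \<epsilon> / 2"
  have "\<delta> > 0"
    using \<open>\<epsilon> > 0\<close> by (simp add: \<delta>_def)
  have "K \<subseteq> (\<Union>x\<in>K. ball x \<delta>)"
    using \<open>\<delta> > 0\<close> by auto
  \<comment> \<open>The centres are chosen inside \<open>K\<close>, where normality is
    known.\<close>
  then obtain k where k: "k \<subseteq> K" "finite k" "K \<subseteq> (\<Union>x\<in>k. ball x \<delta>)"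
    using compactE_image[OF \<open>compact K\<close>, of K "\<lambda>x. ball x \<delta>"] by auto
  have "\<exists>S\<in>{p. finite_dim_projection p}. \<forall>T\<in>{p. finite_dim_projection p}.
      operator_le S T \<longrightarrow> cmod (\<phi> T - \<phi> id_operator) < \<delta>" if "\<phi> \<in> k" for \<phi>
  proof -
    have "\<forall>p\<in>{p :: 'a operator. finite_dim_projection p}. selfadjoint p"
      by (simp add: finite_dim_projection_def projection_def)
    then show ?thesis
      using normal[of \<phi>] that k(1) \<open>\<delta> > 0\<close> operator_directed_finite_dim_projections
        operator_lub_finite_dim_projections
      unfolding normal_functional_def by blast
  qed
  then have "\<forall>\<phi>\<in>k. \<exists>S. finite_dim_projection S \<and> (\<forall>T. finite_dim_projection T \<longrightarrow>
      operator_le S T \<longrightarrow> cmod (\<phi> T - \<phi> id_operator) < \<delta>)"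
    by blast
  then obtain S where S: "\<And>\<phi>. \<phi> \<in> k \<Longrightarrow> finite_dim_projection (S \<phi>)"
    "\<And>\<phi> T. \<phi> \<in> k \<Longrightarrow> finite_dim_projection T \<Longrightarrow> operator_le (S \<phi>) T \<Longrightarrow>
      cmod (\<phi> T - \<phi> id_operator) < \<delta>"
    by metis
  have "\<exists>(n::nat) e. projection (\<Sum>i<n. ketbra (e i) (e i)) \<and>
    (\<forall>p\<in>S ` k. operator_le p (\<Sum>i<n. ketbra (e i) (e i)))"
    using S(1) k(2) by (intro finite_dim_projections_dominated) auto
  then obtain q where q: "finite_dim_projection q" "\<And>\<phi>. \<phi> \<in> k \<Longrightarrow> operator_le (S \<phi>) q"
    using finite_dim_projection_frame by blast
  have proj: "projection q"
    using q(1) by (simp add: finite_dim_projection_def)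
  have "Re (\<theta> n q) > 1 - \<epsilon>" for n
  proof -
    have "\<theta> n \<in> (\<Union>x\<in>k. ball x \<delta>)"
      using k(3) \<open>range \<theta> \<subseteq> K\<close> by blast
    then obtain \<phi> where \<phi>: "\<phi> \<in> k" "dist \<phi> (\<theta> n) < \<delta>"
      by auto
    have "norm (id_operator - q) \<le> 1"
      by (rule norm_projection_le[OF projection_complement[OF proj]])
    then have "norm (\<phi> - \<theta> n) * norm (id_operator - q) \<le> \<delta> * 1"
      using \<phi>(2) \<open>\<delta> > 0\<close> by (intro mult_mono) (simp_all add: dist_norm less_imp_le)
    then have "cmod ((\<phi> - \<theta> n) (id_operator - q)) \<le> \<delta>"
      using norm_cblinfun_apply[of "\<phi> - \<theta> n" "id_operator - q"] by linarith
    moreover have "cmod (\<phi> q - \<phi> id_operator) < \<delta>"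
      by (rule S(2)[OF \<phi>(1) q(1) q(2)[OF \<phi>(1)]])
    \<comment> \<open>One error is that of the centre \<phi> along the projections, the other its
      distance from \<open>\<theta> n\<close>; each is at most half of \<epsilon>.\<close>
    moreover have eq: "\<theta> n q - 1 = (\<phi> q - \<phi> id_operator) + (\<phi> - \<theta> n) (id_operator - q)"
      using \<theta>[of n] by (simp add: state_def cblinfun_diff_right)
    ultimately have "cmod (\<theta> n q - 1) < 2 * \<delta>"
      unfolding eq using norm_triangle_ineq[of "\<phi> q - \<phi> id_operator" "(\<phi> - \<theta> n) (id_operator - q)"]
      by linarith
    then have "\<bar>Re (\<theta> n q - 1)\<bar> < 2 * \<delta>"
      using abs_Re_le_cmod[of "\<theta> n q - 1"] by linarith
    then show ?thesis
      by (simp add: \<delta>_def abs_less_iff)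
  qed
  with q(1) show "\<exists>p. finite_dim_projection p \<and> (\<forall>n. Re (\<theta> n p) > 1 - \<epsilon>)"
    by blast
qed

text \<open>The predual is closed in the dual, so the closure of \<open>A\<close> is the same in
  both spaces.\<close>

lemma relatively_compactin_predual:
  fixes A :: "'a::complex_inner functional set"
  assumes "\<And>\<phi>. \<phi> \<in> A \<Longrightarrow> normal_functional \<phi>"
  shows "relatively_compactin predual_topology A \<longleftrightarrow> compact (closure A)"
proof -
  let ?N = "{\<phi> :: 'a functional. normal_functional \<phi>}"
  have A: "A \<subseteq> ?N"
    using assms by blast
  then have "closure A \<subseteq> ?N"
    by (rule closure_minimal[OF _ closed_normal_functional])
  moreover from A have "predual_topology closure_of A = ?N \<inter> closure A"
    by (simp add: predual_topology_def closure_of_subtopology Int_absorb1)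
  ultimately show ?thesis
    using A by (simp add: relatively_compactin_def predual_topology_def compactin_subtopology
        Int_absorb1)
qed

theorem theorem4p3:
  fixes \<theta> :: "nat \<Rightarrow> 'a::chilbert_space functional"
  assumes "separable_space (euclidean :: 'a topology)"
    and "\<And>n. normal_state (\<theta> n)"
  shows "tight \<theta> \<longleftrightarrow> relatively_compactin predual_topology (range \<theta>)"
proof -
  have \<theta>: "\<And>n. state (\<theta> n)" and normal: "range \<theta> \<subseteq> {\<phi>. normal_functional \<phi>}"
    using assms(2) by (auto simp: normal_state_def)
  then have "closure (range \<theta>) \<subseteq> {\<phi>. normal_functional \<phi>}"
    by (intro closure_minimal closed_normal_functional)
  then have "tight \<theta>" if "compact (closure (range \<theta>))"
    using that by (intro compact_normal_imp_tight[OF \<theta> that _ closure_subset]) auto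
  then have "tight \<theta> \<longleftrightarrow> compact (closure (range \<theta>))"
    using tight_imp_compact_closure[of \<theta>, OF \<theta>] by blast
  also have "\<dots> \<longleftrightarrow> relatively_compactin predual_topology (range \<theta>)"
    using normal by (intro relatively_compactin_predual[symmetric]) blast
  finally show ?thesis .
qed

end
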